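(* Let $\mathcal{B}=\sum_{j=1}^{M}B_j$ be a Bell operator written as a sum of $M$ observables $B_j$, each a tensor product of Pauli operators, so that $\langle B_j\rangle\in[-1,1]$, and let $\langle\mathcal{B}\rangle=\sum_{j=1}^{M}\langle B_j\rangle$. Let $J_1,\dots,J_L$ be independent random variables, each uniformly distributed on $\{1,\dots,M\}$, and define the estimator $$\langle\hat{\mathcal{B}}\rangle_{\infty}=\frac{M}{L}\sum_{l=1}^{L}\langle B_{J_l}\rangle .$$ Then: (1) The estimator is unbiased: $\mathbb{E}[\langle\hat{\mathcal{B}}\rangle_{\infty}]=\langle\mathcal{B}\rangle$. (2) If a violation $\theta>C$ of the Bell inequality $\langle\mathcal{B}\rangle\le C$ is observed and $t=\theta-C$, then the $p$ value satisfies $$p\le\mathbb{P}\big(\langle\hat{\mathcal{B}}\rangle_{\infty}-\langle\mathcal{B}\rangle\ge t\big)\le\exp\left(-\frac{t^{2}}{2M^{2}}L\right).$$ (3) This result yields a lower bound on the necessary $L$: to reach a confidence level of $\gamma=1-p$, $$L\ge\left\lceil-\frac{2M^{2}}{t^{2}}\ln(1-\gamma)\right\rceil$$ random terms of the Bell operator have to be sampled.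
   Context: A Bell inequality has the form $\langle\mathcal{B}\rangle\le C$, where $C$ is the classical bound, satisfied by every local hidden variable (LHV) model. The null hypothesis $H_0$ is that the measurement outcomes can be described by an LHV model, so that $\langle\mathcal{B}\rangle\le C$. The $p$ value for a value $\theta$ is $p=\mathbb{P}(\langle\hat{\mathcal{B}}\rangle_{\infty}>\theta\mid H_0)$, the probability under $H_0$ that the estimator exceeds $\theta$. An observed result is said to have confidence level $\gamma=1-p$. The estimator describes the limit of infinitely many measurements of each sampled term: the expectation values $\langle B_j\rangle$ are assumed to be inferred directly, and the only randomness is in the choice of the indices $J_1,\dots,J_L$.
   Formalization: In (3), L ≥ ⌈…⌉ is shown necessary and sufficient for the confidence 1−exp(−t²L/(2M²)) guaranteed by (2), and sufficient for the true 1−p, with 0 ≤ γ < 1; necessity for the true p value is false (if all ⟨B_j⟩ are equal, p = 0 already at L = 1). *)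

theory Defs
  imports "HOL-Probability.Probability"
begin

section \<open>Pauli observables\<close>

datatype pauli = PI | PX | PY | PZ

fun pauli_mat :: "pauli \<Rightarrow> complex ^ 2 ^ 2" where
  "pauli_mat PI = mat 1"
| "pauli_mat PX = vector [vector [0, 1], vector [1, 0]]"
| "pauli_mat PY = vector [vector [0, - \<i>], vector [\<i>, 0]]"
| "pauli_mat PZ = vector [vector [1, 0], vector [0, - 1]]"

text \<open>The qubits (one per party) are indexed by a finite type \<open>'n\<close>, so the computational basis is
  indexed by \<open>'n \<Rightarrow> 2\<close> and the entries of a tensor product are products of entries.  Pauli strings
  carry a sign because Bell operators such as Mermin's contain terms of the form \<open>- XYY\<close>.\<close>

type_synonym 'n operator = "complex ^ ('n \<Rightarrow> 2) ^ ('n \<Rightarrow> 2)"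

definition pauli_tensor :: "('n::finite \<Rightarrow> pauli) \<Rightarrow> 'n operator" where
  "pauli_tensor P = (\<chi> x y. \<Prod>i\<in>UNIV. pauli_mat (P i) $ x i $ y i)"

definition pauli_observable :: "real \<Rightarrow> ('n::finite \<Rightarrow> pauli) \<Rightarrow> 'n operator" where
  "pauli_observable s P = s *\<^sub>R pauli_tensor P"

definition bell_operator ::
    "nat \<Rightarrow> (nat \<Rightarrow> real) \<Rightarrow> (nat \<Rightarrow> 'n::finite \<Rightarrow> pauli) \<Rightarrow> 'n operator" where
  "bell_operator M s P = (\<Sum>j=1..M. pauli_observable (s j) (P j))"

section \<open>Quantum expectation values\<close>

text \<open>Over the complex numbers, reality of all the quadratic forms already makes \<open>\<rho>\<close> Hermitian.\<close>

definition density_operator :: "'n::finite operator \<Rightarrow> bool" where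
  "density_operator \<rho> \<longleftrightarrow>
     (\<forall>v. (\<Sum>x\<in>UNIV. \<Sum>y\<in>UNIV. cnj (v $ x) * \<rho> $ x $ y * v $ y) \<in> \<real> \<and>
          0 \<le> Re (\<Sum>x\<in>UNIV. \<Sum>y\<in>UNIV. cnj (v $ x) * \<rho> $ x $ y * v $ y)) \<and>
     trace \<rho> = 1"

text \<open>For a Hermitian \<open>A\<close> the trace below is real.\<close>

definition quantum_expectation :: "'n::finite operator \<Rightarrow> 'n operator \<Rightarrow> real" where
  "quantum_expectation \<rho> A = Re (trace (\<rho> ** A))"

definition quantum_values ::
    "(nat \<Rightarrow> real) \<Rightarrow> (nat \<Rightarrow> 'n::finite \<Rightarrow> pauli) \<Rightarrow> (nat \<Rightarrow> real) set" where
  "quantum_values s P =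
     {(\<lambda>j. quantum_expectation \<rho> (pauli_observable (s j) (P j))) | \<rho>. density_operator \<rho>}"

section \<open>Local hidden variable models\<close>

text \<open>The hidden variable is distributed according to \<open>N\<close>; \<open>q i \<sigma> a h\<close> is the probability that
  party \<open>i\<close> obtains the outcome \<open>a\<close> when measuring \<open>\<sigma>\<close>, given the value \<open>h\<close> of the hidden variable.
  Deterministic models are the case where \<open>q\<close> only takes the values 0 and 1.\<close>

definition lhv_model ::
    "'h measure \<Rightarrow> ('n::finite \<Rightarrow> pauli \<Rightarrow> real \<Rightarrow> 'h \<Rightarrow> real) \<Rightarrow> bool" where
  "lhv_model N q \<longleftrightarrow> prob_space N \<and>
     (\<forall>i \<sigma>. (\<forall>a\<in>{-1, 1}. q i \<sigma> a \<in> borel_measurable N) \<and>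
            (\<forall>h\<in>space N. (\<forall>a\<in>{-1, 1}. 0 \<le> q i \<sigma> a h) \<and> (\<Sum>a\<in>{-1, 1}. q i \<sigma> a h) = 1))"

definition lhv_prob ::
    "'h measure \<Rightarrow> ('n::finite \<Rightarrow> pauli \<Rightarrow> real \<Rightarrow> 'h \<Rightarrow> real) \<Rightarrow> ('n \<Rightarrow> pauli) \<Rightarrow> ('n \<Rightarrow> real) \<Rightarrow> real"
  where "lhv_prob N q P a = (\<integral>h. (\<Prod>i\<in>UNIV. q i (P i) (a i) h) \<partial>N)"

text \<open>A party on which the Pauli string acts as the identity is not measured: its response is summed
  out and does not enter the product of outcomes.\<close>

definition lhv_expectation ::
    "'h measure \<Rightarrow> ('n::finite \<Rightarrow> pauli \<Rightarrow> real \<Rightarrow> 'h \<Rightarrow> real) \<Rightarrow> real \<Rightarrow> ('n \<Rightarrow> pauli) \<Rightarrow> real"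
  where
  "lhv_expectation N q s P =
     s * (\<Sum>a\<in>UNIV \<rightarrow>\<^sub>E {-1, 1}. (\<Prod>i | P i \<noteq> PI. a i) * lhv_prob N q P a)"

definition lhv_values ::
    "'h itself \<Rightarrow> (nat \<Rightarrow> real) \<Rightarrow> (nat \<Rightarrow> 'n::finite \<Rightarrow> pauli) \<Rightarrow> (nat \<Rightarrow> real) set" where
  "lhv_values T s P =
     {(\<lambda>j. lhv_expectation N q (s j) (P j)) | (N :: 'h measure) q. lhv_model N q}"

section \<open>Random sampling of terms\<close>

text \<open>In the following, \<open>e j\<close> is the expectation value of the \<open>j\<close>-th term of the Bell operator.\<close>

definition bell_value :: "nat \<Rightarrow> (nat \<Rightarrow> real) \<Rightarrow> real" where
  "bell_value M e = (\<Sum>j=1..M. e j)"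

text \<open>\<open>C\<close> need not be the smallest such bound.\<close>

definition bell_inequality ::
    "'h itself \<Rightarrow> nat \<Rightarrow> (nat \<Rightarrow> real) \<Rightarrow> (nat \<Rightarrow> 'n::finite \<Rightarrow> pauli) \<Rightarrow> real \<Rightarrow> bool" where
  "bell_inequality T M s P C \<longleftrightarrow> (\<forall>e\<in>lhv_values T s P. bell_value M e \<le> C)"

definition estimator ::
    "nat \<Rightarrow> nat \<Rightarrow> (nat \<Rightarrow> real) \<Rightarrow> (nat \<Rightarrow> 'w \<Rightarrow> nat) \<Rightarrow> 'w \<Rightarrow> real" where
  "estimator M L e J \<omega> = real M / real L * (\<Sum>l=1..L. e (J l \<omega>))"

text \<open>This is the p value at \<open>\<theta>\<close> when \<open>e\<close> is taken from \<open>lhv_values\<close>, i.e. under the null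
  hypothesis.\<close>

definition p_value ::
    "'w measure \<Rightarrow> nat \<Rightarrow> nat \<Rightarrow> (nat \<Rightarrow> real) \<Rightarrow> (nat \<Rightarrow> 'w \<Rightarrow> nat) \<Rightarrow> real \<Rightarrow> real" where
  "p_value W M L e J \<theta> = measure W {\<omega>\<in>space W. estimator M L e J \<omega> > \<theta>}"

definition uniform_sample :: "'w measure \<Rightarrow> nat \<Rightarrow> nat \<Rightarrow> (nat \<Rightarrow> 'w \<Rightarrow> nat) \<Rightarrow> bool" where
  "uniform_sample W M L J \<longleftrightarrow> prob_space W \<and>
     prob_space.indep_vars W (\<lambda>_. count_space UNIV) J {1..L} \<and>
     (\<forall>l\<in>{1..L}. distr W (count_space UNIV) (J l) = measure_pmf (pmf_of_set {1..M}))"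

end

(* The positive 2 x 2 principal minors of a density operator give
   |rho_xy| <= (rho_xx + rho_yy) / 2.  A tensor product of Pauli matrices has absolute row and column
   sums equal to 1, so |tr (rho A)| <= tr rho = 1 follows by summing these bounds.  In a local hidden
   variable model, the expectation is an average of signs with respect to the joint outcome
   probabilities.  Either way the sampled values are independent and lie in [-1, 1], and Hoeffding's
   inequality for their sum, with deviation t L / M, is the tail bound. *)

theory Submission
  imports Defs
begin

section \<open>Absolute row and column sums of Pauli tensors\<close>

lemma pauli_row_sum: "(\<Sum>b\<in>UNIV. cmod (pauli_mat p $ a $ b)) = 1"
  by (cases p; cases a rule: exhaust_2[THEN disjE]) (auto simp: mat_def sum_2)

lemma pauli_col_sum: "(\<Sum>a\<in>UNIV. cmod (pauli_mat p $ a $ b)) = 1"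
  by (cases p; cases b rule: exhaust_2[THEN disjE]) (auto simp: mat_def sum_2)

text \<open>Each row of a Pauli matrix has a single nonzero entry, of modulus 1. Since
  \<open>y\<close> ranges over all choices of one index per party, the sum of products factors into
  the single-party row sums.\<close>

lemma pauli_tensor_row_sum: "(\<Sum>y\<in>UNIV. cmod (pauli_tensor P $ x $ y)) = 1"
proof -
  have "(\<Sum>y\<in>UNIV. cmod (pauli_tensor P $ x $ y))
      = (\<Prod>i\<in>UNIV. \<Sum>b\<in>UNIV. cmod (pauli_mat (P i) $ x i $ b))"
    by (subst prod_sum_PiE) (auto simp: pauli_tensor_def prod_norm PiE_UNIV_domain)
  then show ?thesis
    by (simp add: pauli_row_sum)
qed

lemma pauli_tensor_col_sum: "(\<Sum>x\<in>UNIV. cmod (pauli_tensor P $ x $ y)) = 1"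
proof -
  have "(\<Sum>x\<in>UNIV. cmod (pauli_tensor P $ x $ y))
      = (\<Prod>i\<in>UNIV. \<Sum>a\<in>UNIV. cmod (pauli_mat (P i) $ a $ y i))"
    by (subst prod_sum_PiE) (auto simp: pauli_tensor_def prod_norm PiE_UNIV_domain)
  then show ?thesis
    by (simp add: pauli_col_sum)
qed

section \<open>Density operators and bounds on quantum expectations\<close>

lemma density_operator_form:
  fixes \<rho> :: "'n::finite operator"
  assumes "density_operator \<rho>" "x \<noteq> y"
  defines "z \<equiv> \<lambda>a b. cnj a * \<rho> $ x $ x * a + cnj a * \<rho> $ x $ y * b
      + cnj b * \<rho> $ y $ x * a + cnj b * \<rho> $ y $ y * b"
  shows "z a b \<in> \<real>" "0 \<le> Re (z a b)"
proof -
  \<comment> \<open>A vector supported on \<open>x\<close> and \<open>y\<close> restricts the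
    quadratic form to the corresponding 2 x 2 principal submatrix.\<close>
  define v :: "complex ^ ('n \<Rightarrow> 2)" where "v = (\<chi> u. if u = x then a else if u = y then b else 0)"
  have red: "(\<Sum>u\<in>UNIV. f u) = f x + f y" if "\<And>u. u \<noteq> x \<Longrightarrow> u \<noteq> y \<Longrightarrow> f u = 0" for f :: "('n \<Rightarrow> 2) \<Rightarrow> complex"
  proof -
    have "(\<Sum>u\<in>UNIV. f u) = (\<Sum>u\<in>{x, y}. f u)"
      using that by (intro sum.mono_neutral_right) auto
    then show ?thesis using assms(2) by simp
  qed
  have "(\<Sum>u\<in>UNIV. \<Sum>w\<in>UNIV. cnj (v $ u) * \<rho> $ u $ w * v $ w)
      = (\<Sum>u\<in>UNIV. cnj (v $ u) * \<rho> $ u $ x * a + cnj (v $ u) * \<rho> $ u $ y * b)"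
    using assms(2) by (intro sum.cong refl, subst red) (auto simp: v_def)
  also have "\<dots> = z a b"
    using assms(2) by (subst red) (auto simp: v_def z_def)
  finally have eq: "(\<Sum>u\<in>UNIV. \<Sum>w\<in>UNIV. cnj (v $ u) * \<rho> $ u $ w * v $ w) = z a b" .
  show "z a b \<in> \<real>" "0 \<le> Re (z a b)"
    using assms(1) unfolding density_operator_def eq[symmetric] by blast+
qed

lemma density_operator_diag:
  assumes "density_operator \<rho>"
  shows "\<rho> $ x $ x \<in> \<real>" "0 \<le> Re (\<rho> $ x $ x)"
proof -
  have "(\<Sum>u\<in>UNIV. \<Sum>w\<in>UNIV. cnj (axis x 1 $ u) * \<rho> $ u $ w * axis x 1 $ w)
      = (\<Sum>u\<in>{x}. \<Sum>w\<in>UNIV. cnj (axis x 1 $ u) * \<rho> $ u $ w * axis x 1 $ w)"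
    by (rule sum.mono_neutral_right) (auto simp: axis_def)
  also have "\<dots> = (\<Sum>u\<in>{x}. \<Sum>w\<in>{x}. cnj (axis x 1 $ u) * \<rho> $ u $ w * axis x 1 $ w)"
    by (intro sum.cong refl sum.mono_neutral_right) (auto simp: axis_def)
  also have "\<dots> = \<rho> $ x $ x"
    by (simp add: axis_def)
  finally have eq: "(\<Sum>u\<in>UNIV. \<Sum>w\<in>UNIV. cnj (axis x 1 $ u) * \<rho> $ u $ w * axis x 1 $ w)
      = \<rho> $ x $ x" .
  show "\<rho> $ x $ x \<in> \<real>" "0 \<le> Re (\<rho> $ x $ x)"
    using assms unfolding density_operator_def eq[symmetric] by blast+
qed

text \<open>An additive form of the Cauchy-Schwarz bound on the minor: being linear in the diagonal,
  it can be summed against the trace.\<close>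

lemma density_operator_entry_le:
  assumes "density_operator \<rho>"
  shows "cmod (\<rho> $ x $ y) \<le> (Re (\<rho> $ x $ x) + Re (\<rho> $ y $ y)) / 2"
proof (cases "x = y")
  case True
  then show ?thesis
    using density_operator_diag[OF assms, of y] by (simp add: norm_real complex_is_Real_iff cmod_def)
next
  case False
  note form = density_operator_form[OF assms False]
  note diag = density_operator_diag(1)[OF assms]
  \<comment> \<open>Polarization: reality of the form at \<open>(1, 1)\<close> makes the imaginary
    parts of the two off-diagonal entries opposite, and reality at \<open>(1, \<i>)\<close> makes
    their real parts equal.\<close>
  have herm: "\<rho> $ y $ x = cnj (\<rho> $ x $ y)"
    using form(1)[of 1 1] form(1)[of 1 "\<i>"] diag[of x] diag[of y]
    by (auto simp: complex_is_Real_iff complex_eq_iff)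
  \<comment> \<open>The phase of \<open>b\<close> turns the cross terms of the form at \<open>(1, b)\<close> into
    \<open>- 2 \<bar>\<rho>\<^sub>x\<^sub>y\<bar>\<close>; \<open>b = 0\<close> if \<open>\<rho>\<^sub>x\<^sub>y = 0\<close>.\<close>
  define b where "b = - cnj (sgn (\<rho> $ x $ y))"
  have sgn: "z * cnj (sgn z) = of_real (cmod z)" for z
    using complex_norm_square[of z] by (cases "z = 0") (simp_all add: sgn_eq power2_eq_square field_simps)
  have b: "\<rho> $ x $ y * b = - complex_of_real (cmod (\<rho> $ x $ y))"
    by (simp add: b_def sgn)
  have b1: "cmod b \<le> 1"
    by (simp add: b_def norm_sgn)
  have "cnj b * \<rho> $ y $ x = - complex_of_real (cmod (\<rho> $ x $ y))"
    using arg_cong[OF b, of cnj] by (simp add: herm mult.commute)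
  moreover have "Re (cnj b * \<rho> $ y $ y * b) = (cmod b)\<^sup>2 * Re (\<rho> $ y $ y)"
    using diag[of y] unfolding cmod_power2
    by (simp add: complex_is_Real_iff power2_eq_square algebra_simps)
  ultimately have "2 * cmod (\<rho> $ x $ y) \<le> Re (\<rho> $ x $ x) + (cmod b)\<^sup>2 * Re (\<rho> $ y $ y)"
    using form(2)[of 1 b] b by (simp del: times_complex.sel, simp)
  \<comment> \<open>Nonnegativity of the diagonal entry lets the coefficient grow to 1, which covers
    both a unit phase and \<open>b = 0\<close>.\<close>
  also have "(cmod b)\<^sup>2 * Re (\<rho> $ y $ y) \<le> 1 * Re (\<rho> $ y $ y)"
    using b1 density_operator_diag(2)[OF assms] by (intro mult_right_mono) (auto simp: power_le_one)
  finally show ?thesis by simp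
qed

lemma abs_quantum_expectation_le_1:
  assumes "density_operator \<rho>"
    and row: "\<And>x. (\<Sum>y\<in>UNIV. cmod (A $ x $ y)) \<le> 1"
    and col: "\<And>y. (\<Sum>x\<in>UNIV. cmod (A $ x $ y)) \<le> 1"
  shows "\<bar>quantum_expectation \<rho> A\<bar> \<le> 1"
proof -
  define d where "d x = Re (\<rho> $ x $ x)" for x
  have d: "0 \<le> d x" for x
    using density_operator_diag(2)[OF assms(1)] by (simp add: d_def)
  have tr: "(\<Sum>x\<in>UNIV. d x) = 1"
  proof -
    have "Re (trace \<rho>) = 1"
      using assms(1) by (simp add: density_operator_def)
    then show ?thesis
      by (simp add: trace_def d_def)
  qed
  have "\<bar>quantum_expectation \<rho> A\<bar> \<le> cmod (\<Sum>x\<in>UNIV. \<Sum>y\<in>UNIV. \<rho> $ x $ y * A $ y $ x)"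
    unfolding quantum_expectation_def trace_def matrix_matrix_mult_def vec_lambda_beta
    by (rule abs_Re_le_cmod)
  also have "\<dots> \<le> (\<Sum>x\<in>UNIV. \<Sum>y\<in>UNIV. cmod (\<rho> $ x $ y) * cmod (A $ y $ x))"
    by (intro sum_norm_le) (simp add: norm_mult)
  also have "\<dots> \<le> (\<Sum>x\<in>UNIV. \<Sum>y\<in>UNIV. (d x * cmod (A $ y $ x) + d y * cmod (A $ y $ x)) / 2)"
  proof (intro sum_mono)
    fix x y
    have "cmod (\<rho> $ x $ y) * cmod (A $ y $ x) \<le> (d x + d y) / 2 * cmod (A $ y $ x)"
      using density_operator_entry_le[OF assms(1)] unfolding d_def
      by (rule mult_right_mono) simp
    then show "cmod (\<rho> $ x $ y) * cmod (A $ y $ x)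
        \<le> (d x * cmod (A $ y $ x) + d y * cmod (A $ y $ x)) / 2"
      by (simp add: distrib_right)
  qed
  also have "\<dots> = ((\<Sum>x\<in>UNIV. \<Sum>y\<in>UNIV. d x * cmod (A $ y $ x))
      + (\<Sum>x\<in>UNIV. \<Sum>y\<in>UNIV. d y * cmod (A $ y $ x))) / 2"
    by (simp add: sum.distrib flip: sum_divide_distrib)
  \<comment> \<open>With \<open>y\<close> fixed the inner sum runs along a row of \<open>A\<close>;
    the other half, with \<open>x\<close> fixed, runs along a column. Each half contributes at most
    the trace of \<open>\<rho>\<close>.\<close>
  also have "(\<Sum>x\<in>UNIV. \<Sum>y\<in>UNIV. d y * cmod (A $ y $ x)) = (\<Sum>y\<in>UNIV. d y * (\<Sum>x\<in>UNIV. cmod (A $ y $ x)))"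
    by (subst sum.swap) (simp add: sum_distrib_left)
  also have "\<dots> \<le> (\<Sum>y\<in>UNIV. d y)"
    using row d by (intro sum_mono mult_left_le)
  also have "(\<Sum>x\<in>UNIV. \<Sum>y\<in>UNIV. d x * cmod (A $ y $ x)) = (\<Sum>x\<in>UNIV. d x * (\<Sum>y\<in>UNIV. cmod (A $ y $ x)))"
    by (simp add: sum_distrib_left)
  also have "\<dots> \<le> (\<Sum>x\<in>UNIV. d x)"
    using col d by (intro sum_mono mult_left_le)
  finally show ?thesis by (simp add: tr)
qed

lemma abs_quantum_expectation_pauli_le_1:
  assumes "density_operator \<rho>" "\<bar>s\<bar> \<le> 1"
  shows "\<bar>quantum_expectation \<rho> (pauli_observable s P)\<bar> \<le> 1"
  using assms
  by (intro abs_quantum_expectation_le_1)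
    (simp_all add: pauli_observable_def pauli_tensor_row_sum pauli_tensor_col_sum flip: sum_distrib_left)

text \<open>Linearity identifies the sum of the term expectations with the expectation of the Bell
  operator.\<close>

lemma quantum_expectation_sum:
  "quantum_expectation \<rho> (\<Sum>j\<in>I. A j) = (\<Sum>j\<in>I. quantum_expectation \<rho> (A j))"
proof (induction I rule: infinite_finite_induct)
  case (insert j I)
  then show ?case
    by (simp add: quantum_expectation_def matrix_add_ldistrib trace_add)
\<comment> \<open>For empty \<open>I\<close> both sums are 0, and for infinite \<open>I\<close> they
  are 0 by the default value of \<open>sum\<close>.\<close>
qed (simp_all add: quantum_expectation_def trace_def)

section \<open>Local hidden variable models\<close>

lemma lhv_prob_nonneg:
  assumes "lhv_model N q" "range a \<subseteq> {-1, 1}"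
  shows "0 \<le> lhv_prob N q P a"
proof -
  have "0 \<le> q i \<sigma> (a i) h" if "h \<in> space N" for i \<sigma> h
    using assms that unfolding lhv_model_def by blast
  then show ?thesis
    unfolding lhv_prob_def
    by (intro Bochner_Integration.integral_nonneg_AE AE_I2 prod_nonneg) auto
qed

text \<open>For a fixed hidden value the joint response is a product over the parties, so its sum
  over all outcome tuples factors into total probabilities, each equal to 1.\<close>

lemma sum_lhv_prob:
  assumes "lhv_model N q"
  shows "(\<Sum>a\<in>UNIV \<rightarrow>\<^sub>E {-1, 1}. lhv_prob N q P a) = 1"
proof -
  interpret prob_space N
    using assms by (simp add: lhv_model_def)
  have meas: "q i \<sigma> a \<in> borel_measurable N" if "a \<in> {-1, 1}" for i \<sigma> a
    using assms that unfolding lhv_model_def by blast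
  have nn: "0 \<le> q i \<sigma> a h" if "a \<in> {-1, 1}" "h \<in> space N" for i \<sigma> a h
    using assms that unfolding lhv_model_def by blast
  have one: "(\<Sum>a\<in>{-1, 1}. q i \<sigma> a h) = 1" if "h \<in> space N" for i \<sigma> h
    using assms that unfolding lhv_model_def by blast
  have le1: "q i \<sigma> a h \<le> 1" if "a \<in> {-1, 1}" "h \<in> space N" for i \<sigma> a h
    using one[OF that(2), of i \<sigma>] nn[of 1 h i \<sigma>] nn[of "-1" h i \<sigma>] that by auto
  \<comment> \<open>The integrand is a product of probabilities, dominated by the constant 1;
    integrability permits moving the sum over outcomes inside the integral.\<close>
  have int: "integrable N (\<lambda>h. \<Prod>i\<in>UNIV. q i (P i) (a i) h)" if "a \<in> UNIV \<rightarrow>\<^sub>E {-1, 1}" for a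
  proof (rule integrable_const_bound[where B = 1])
    show "AE h in N. norm (\<Prod>i\<in>UNIV. q i (P i) (a i) h) \<le> 1"
      using that nn le1 
      by (intro AE_I2) (auto simp: abs_prod PiE_iff intro!: prod_le_1)
    show "(\<lambda>h. \<Prod>i\<in>UNIV. q i (P i) (a i) h) \<in> borel_measurable N"
      using that by (intro borel_measurable_prod meas) (auto simp: PiE_iff)
  qed
  have "(\<Sum>a\<in>UNIV \<rightarrow>\<^sub>E {-1, 1}. lhv_prob N q P a)
      = (\<integral>h. (\<Sum>a\<in>UNIV \<rightarrow>\<^sub>E {-1, 1}. \<Prod>i\<in>UNIV. q i (P i) (a i) h) \<partial>N)"
    unfolding lhv_prob_def by (rule Bochner_Integration.integral_sum[symmetric]) (rule int)
  also have "\<dots> = (\<integral>h. 1 \<partial>N)"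
    by (intro Bochner_Integration.integral_cong refl) (subst prod_sum_PiE[symmetric], simp_all add: one del: sum.insert)
  finally show ?thesis by (simp add: prob_space)
qed

lemma abs_lhv_expectation_le_1:
  fixes P :: "'n::finite \<Rightarrow> pauli"
  assumes "lhv_model N q" "\<bar>s\<bar> \<le> 1"
  shows "\<bar>lhv_expectation N q s P\<bar> \<le> 1"
proof -
  have "\<bar>\<Sum>a\<in>UNIV \<rightarrow>\<^sub>E {-1, 1}. (\<Prod>i | P i \<noteq> PI. a i) * lhv_prob N q P a\<bar>
      \<le> (\<Sum>a\<in>UNIV \<rightarrow>\<^sub>E {-1, 1}. \<bar>(\<Prod>i | P i \<noteq> PI. a i) * lhv_prob N q P a\<bar>)"
    by (rule sum_abs)
  also have "\<dots> \<le> (\<Sum>a\<in>UNIV \<rightarrow>\<^sub>E {-1, 1}. lhv_prob N q P a)"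
  proof (rule sum_mono)
    fix a :: "'n \<Rightarrow> real"
    assume a: "a \<in> UNIV \<rightarrow>\<^sub>E {-1, 1}"
    \<comment> \<open>The product runs only over the measured parties; as all outcomes have modulus
      1, it is a sign whichever parties are left out.\<close>
    then have "\<bar>a i\<bar> = 1" for i
      by (auto simp: PiE_iff dest: spec[of _ i])
    moreover have "0 \<le> lhv_prob N q P a"
      using a by (intro lhv_prob_nonneg[OF assms(1)]) (auto simp: PiE_iff)
    ultimately show "\<bar>(\<Prod>i | P i \<noteq> PI. a i) * lhv_prob N q P a\<bar> \<le> lhv_prob N q P a"
      by (simp add: abs_mult abs_prod)
  qed
  finally show ?thesis
    using assms(2) unfolding lhv_expectation_def sum_lhv_prob[OF assms(1)]
    by (simp add: abs_mult mult_le_one)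
qed

section \<open>Uniform sampling of arbitrary values in [-1, 1], quantum or hidden variable\<close>

locale bounded_uniform_sample = prob_space W for W :: "'w measure" +
  fixes M L :: nat and J :: "nat \<Rightarrow> 'w \<Rightarrow> nat" and e :: "nat \<Rightarrow> real"
  assumes M: "M \<ge> 1" and L: "L \<ge> 1"
    and sample: "uniform_sample W M L J"
    and e: "\<And>j. j \<in> {1..M} \<Longrightarrow> e j \<in> {-1..1}"
begin

lemma J_measurable: "l \<in> {1..L} \<Longrightarrow> J l \<in> measurable W (count_space UNIV)"
  using sample unfolding uniform_sample_def indep_vars_def by blast

lemma distr_J: "l \<in> {1..L} \<Longrightarrow> distr W (count_space UNIV) (J l) = measure_pmf (pmf_of_set {1..M})"
  using sample unfolding uniform_sample_def by blast

lemma term_measurable: "l \<in> {1..L} \<Longrightarrow> (\<lambda>\<omega>. e (J l \<omega>)) \<in> borel_measurable W"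
  using J_measurable by (rule measurable_compose) auto

text \<open>The bound is almost sure because only the law of \<open>J l\<close> is known: the index
  may leave \<open>{1..M}\<close> on a null set, where \<open>e\<close> is unconstrained.\<close>

lemma term_bounded:
  assumes "l \<in> {1..L}"
  shows "AE \<omega> in W. e (J l \<omega>) \<in> {-1..1}"
proof -
  have "AE j in measure_pmf (pmf_of_set {1..M}). e j \<in> {-1..1}"
    using M e by (subst AE_measure_pmf_iff) (auto simp: set_pmf_of_set)
  then show ?thesis
    unfolding distr_J[OF assms, symmetric] using J_measurable[OF assms] by (subst (asm) AE_distr_iff) auto
qed

text \<open>Hoeffding's setting is instantiated for the unscaled sampled values. Their independence
  is inherited from the indices, since each value is a function of one index.\<close>

sublocale terms: Hoeffding_ineq W "{1..L}" "\<lambda>l \<omega>. e (J l \<omega>)" "\<lambda>_. -1" "\<lambda>_. 1"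
    "\<Sum>l=1..L. expectation (\<lambda>\<omega>. e (J l \<omega>))"
proof unfold_locales
  show "indep_vars (\<lambda>_. borel) (\<lambda>l \<omega>. e (J l \<omega>)) {1..L}"
    using sample unfolding uniform_sample_def by (intro indep_vars_compose2[where Y = "\<lambda>_. e"]) auto
qed (use term_bounded in auto)

lemma term_integrable:
  assumes "l \<in> {1..L}"
  shows "integrable W (\<lambda>\<omega>. e (J l \<omega>))"
  by (rule integrable_const_bound[where B = 1])
    (use term_bounded[OF assms] term_measurable[OF assms] in auto)

lemma expectation_term:
  assumes "l \<in> {1..L}"
  shows "expectation (\<lambda>\<omega>. e (J l \<omega>)) = bell_value M e / M"
proof -
  have "expectation (\<lambda>\<omega>. e (J l \<omega>)) = (\<integral>j. e j \<partial>distr W (count_space UNIV) (J l))"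
    using J_measurable[OF assms] by (subst integral_distr) auto
  also have "\<dots> = bell_value M e / M"
    unfolding distr_J[OF assms] using M by (subst integral_pmf_of_set) (auto simp: bell_value_def)
  finally show ?thesis .
qed

lemma estimator_measurable: "estimator M L e J \<in> borel_measurable W"
  unfolding estimator_def[abs_def] using term_measurable by measurable

lemma estimator_integrable: "integrable W (estimator M L e J)"
  unfolding estimator_def[abs_def]
  by (intro integrable_mult_right Bochner_Integration.integrable_sum term_integrable)

text \<open>Each of the \<open>L\<close> sampled values has mean \<open>bell_value M e / M\<close>,
  which the prefactor \<open>M / L\<close> exactly compensates.\<close>

lemma expectation_estimator: "expectation (estimator M L e J) = bell_value M e"
proof -
  have "expectation (estimator M L e J) = M / L * (\<Sum>l=1..L. expectation (\<lambda>\<omega>. e (J l \<omega>)))"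
    unfolding estimator_def[abs_def] using term_integrable
    by (simp add: Bochner_Integration.integral_sum)
  then show ?thesis
    using M L by (simp add: expectation_term)
qed

lemma estimator_tail_bound:
  assumes "0 \<le> t"
  shows "prob {\<omega>\<in>space W. estimator M L e J \<omega> - bell_value M e \<ge> t}
    \<le> exp (- (t\<^sup>2 / (2 * (real M)\<^sup>2)) * real L)"
proof -
  \<comment> \<open>Undoing the prefactor turns a deviation \<open>t\<close> of the estimator into a
    deviation \<open>t * L / M\<close> of the sum.\<close>
  have "{\<omega>\<in>space W. estimator M L e J \<omega> - bell_value M e \<ge> t}
      = {\<omega>\<in>space W. (\<Sum>l=1..L. e (J l \<omega>)) \<ge> (\<Sum>l=1..L. expectation (\<lambda>\<omega>. e (J l \<omega>))) + t * L / M}"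
    using M L by (auto simp: estimator_def expectation_term field_simps)
  also have "prob \<dots> \<le> exp (- 2 * (t * L / M)\<^sup>2 / (\<Sum>l=1..L. (1 - (-1))\<^sup>2))"
    using assms L by (intro terms.Hoeffding_ineq_ge) auto
  \<comment> \<open>Every range has length 2, so the denominator is \<open>4 * L\<close>, positive
    as \<open>L\<close> is at least 1.\<close>
  also have "- 2 * (t * L / M)\<^sup>2 / (\<Sum>l=1..L. (1 - (-1))\<^sup>2) = - (t\<^sup>2 / (2 * (real M)\<^sup>2)) * real L"
    using M L by (simp add: field_simps power2_eq_square)
  finally show ?thesis .
qed

text \<open>The null hypothesis enters as the bound \<open>C\<close> on the mean: an estimate above
  \<open>\<theta>\<close> then exceeds the mean by more than \<open>\<theta> - C\<close>.\<close>

lemma p_value_le_tail: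
  assumes "bell_value M e \<le> C"
  shows "p_value W M L e J \<theta> \<le> prob {\<omega>\<in>space W. estimator M L e J \<omega> - bell_value M e \<ge> \<theta> - C}"
  unfolding p_value_def
proof (rule finite_measure_mono)
  show "{\<omega>\<in>space W. estimator M L e J \<omega> - bell_value M e \<ge> \<theta> - C} \<in> sets W"
    using estimator_measurable by measurable
qed (use assms in auto)

end

section \<open>Sample size for a given confidence level\<close>

lemma confidence_iff_sample_size:
  fixes t \<gamma> :: real and M L :: nat
  assumes "M \<ge> 1" "t > 0" "\<gamma> < 1"
  shows "1 - exp (- (t\<^sup>2 / (2 * (real M)\<^sup>2)) * real L) \<ge> \<gamma> \<longleftrightarrow>
    int L \<ge> \<lceil>- (2 * (real M)\<^sup>2 / t\<^sup>2) * ln (1 - \<gamma>)\<rceil>"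
proof -
  \<comment> \<open>Since \<open>\<gamma> < 1\<close>, the number \<open>1 - \<gamma>\<close> is
    positive and taking logarithms leaves a condition linear in \<open>L\<close>.\<close>
  have "1 - exp (- (t\<^sup>2 / (2 * (real M)\<^sup>2)) * real L) \<ge> \<gamma> \<longleftrightarrow>
      - (t\<^sup>2 / (2 * (real M)\<^sup>2)) * real L \<le> ln (1 - \<gamma>)"
    using assms by (subst ln_ge_iff) auto
  also have "\<dots> \<longleftrightarrow> - ln (1 - \<gamma>) \<le> (t\<^sup>2 / (2 * (real M)\<^sup>2)) * real L"
    by auto
  also have "\<dots> \<longleftrightarrow> - (2 * (real M)\<^sup>2 / t\<^sup>2) * ln (1 - \<gamma>) \<le> real L"
    using assms by (simp add: field_simps)
  finally show ?thesis
    \<comment> \<open>As \<open>L\<close> is an integer, rounding the bound up gives an equivalent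
      condition.\<close>
    by (simp add: ceiling_le_iff)
qed

section \<open>Unbiasedness, tail bound and confidence for Bell operators\<close>

theorem mainTheorem1:
  fixes W :: "'w measure" and J :: "nat \<Rightarrow> 'w \<Rightarrow> nat"
    and M L :: nat and s :: "nat \<Rightarrow> real" and P :: "nat \<Rightarrow> 'n::finite \<Rightarrow> pauli"
    and C :: real
  assumes "M \<ge> 1" and "L \<ge> 1"
    and "\<forall>j\<in>{1..M}. s j \<in> {-1, 1}"
    and "uniform_sample W M L J"
    and "bell_inequality TYPE('h) M s P C"
  shows
    "(\<forall>\<rho>. density_operator \<rho> \<longrightarrow>
        bell_value M (\<lambda>j. quantum_expectation \<rho> (pauli_observable (s j) (P j))) =
        quantum_expectation \<rho> (bell_operator M s P)) \<and>
     (\<forall>e\<in>quantum_values s P \<union> lhv_values TYPE('h) s P.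
        (\<forall>j\<in>{1..M}. e j \<in> {-1..1}) \<and>
        integrable W (estimator M L e J) \<and>
        (\<integral>\<omega>. estimator M L e J \<omega> \<partial>W) = bell_value M e) \<and>
     (\<forall>\<theta> t. \<theta> > C \<and> t = \<theta> - C \<longrightarrow>
        (\<forall>e\<in>lhv_values TYPE('h) s P.
           p_value W M L e J \<theta> \<le>
             measure W {\<omega>\<in>space W. estimator M L e J \<omega> - bell_value M e \<ge> t}) \<and>
        (\<forall>e\<in>quantum_values s P \<union> lhv_values TYPE('h) s P.
           measure W {\<omega>\<in>space W. estimator M L e J \<omega> - bell_value M e \<ge> t} \<le>
             exp (- (t\<^sup>2 / (2 * (real M)\<^sup>2)) * real L)) \<and>
        (\<forall>\<gamma>. 0 \<le> \<gamma> \<and> \<gamma> < 1 \<longrightarrow>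
           (1 - exp (- (t\<^sup>2 / (2 * (real M)\<^sup>2)) * real L) \<ge> \<gamma> \<longleftrightarrow>
              int L \<ge> \<lceil>- (2 * (real M)\<^sup>2 / t\<^sup>2) * ln (1 - \<gamma>)\<rceil>) \<and>
           (int L \<ge> \<lceil>- (2 * (real M)\<^sup>2 / t\<^sup>2) * ln (1 - \<gamma>)\<rceil> \<longrightarrow>
              (\<forall>e\<in>lhv_values TYPE('h) s P. 1 - p_value W M L e J \<theta> \<ge> \<gamma>))))"
proof -
  let ?V = "quantum_values s P \<union> lhv_values TYPE('h) s P"
  have s: "\<bar>s j\<bar> \<le> 1" if "j \<in> {1..M}" for j
    using assms(3) that by fastforce
  have bounded: "e j \<in> {-1..1}" if "e \<in> ?V" "j \<in> {1..M}" for e j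
  proof -
    have "\<bar>e j\<bar> \<le> 1"
      using that(1) abs_quantum_expectation_pauli_le_1[OF _ s[OF that(2)]]
        abs_lhv_expectation_le_1[OF _ s[OF that(2)]]
      by (auto simp: quantum_values_def lhv_values_def)
    then show ?thesis
      by auto
  qed
  \<comment> \<open>Both kinds of values lie in [-1, 1], so the sampling results apply to them
    alike.\<close>
  have sample: "bounded_uniform_sample W M L J e" if "e \<in> ?V" for e
    using assms(1,2,4) bounded[OF that]
    by (intro bounded_uniform_sample.intro bounded_uniform_sample_axioms.intro)
      (auto simp: uniform_sample_def)
  have linear: "bell_value M (\<lambda>j. quantum_expectation \<rho> (pauli_observable (s j) (P j))) =
      quantum_expectation \<rho> (bell_operator M s P)" for \<rho>
    by (simp add: bell_value_def bell_operator_def quantum_expectation_sum)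
  \<comment> \<open>The Bell inequality bounds the mean of hidden variable values by
    \<open>C\<close>, hence the restriction to \<open>lhv_values\<close>.\<close>
  have p_le: "p_value W M L e J \<theta>
      \<le> measure W {\<omega>\<in>space W. estimator M L e J \<omega> - bell_value M e \<ge> \<theta> - C}"
    if "e \<in> lhv_values TYPE('h) s P" for e \<theta>
    using bounded_uniform_sample.p_value_le_tail[OF sample] assms(5) that
    by (simp add: bell_inequality_def)
  \<comment> \<open>The p value is at most the tail probability, which is at most the exponential
    and hence at most \<open>1 - \<gamma>\<close>.\<close>
  have conf: "\<gamma> \<le> 1 - p_value W M L e J \<theta>"
    if "e \<in> lhv_values TYPE('h) s P" "\<theta> > C"
      "\<gamma> \<le> 1 - exp (- ((\<theta> - C)\<^sup>2 / (2 * (real M)\<^sup>2)) * real L)" for e \<theta> \<gamma>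
    using p_le[OF that(1), of \<theta>] that
      bounded_uniform_sample.estimator_tail_bound[OF sample, of e "\<theta> - C"] by auto
  show ?thesis
  proof (intro conjI allI impI ballI, goal_cases)
    case 1
    show ?case
      by (rule linear)
  next
    case (2 e j)
    then show ?case
      by (rule bounded)
  next
    case (3 e)
    then show ?case
      by (intro bounded_uniform_sample.estimator_integrable sample)
  next
    case (4 e)
    then show ?case
      by (intro bounded_uniform_sample.expectation_estimator sample)
  next
    case (5 \<theta> t e)
    then show ?case
      using p_le by blast
  next
    case (6 \<theta> t e)
    then show ?case
      by (intro bounded_uniform_sample.estimator_tail_bound sample) auto
  next
    case (7 \<theta> t \<gamma>)
    then show ?case
      using assms(1) by (intro confidence_iff_sample_size) auto
  next
    case (8 \<theta> t \<gamma> e)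
    \<comment> \<open>The equivalence is read backwards: a large enough \<open>L\<close> makes the
      exponential at most \<open>1 - \<gamma>\<close>.\<close>
    then have "\<gamma> \<le> 1 - exp (- (t\<^sup>2 / (2 * (real M)\<^sup>2)) * real L)"
      using assms(1) by (subst confidence_iff_sample_size) auto
    then show ?case
      using 8 conf by blast
  qed
qed

end
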